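(* Let $F:\mathbb{R}^d\to\mathbb{R}$ be twice differentiable and attain minimum value $0$. (i) If $\|\nabla^2F(w)\|_{\mathrm{op}}\le l(\|\nabla F(w)\|)$ for all $w\in\mathbb{R}^d$, where $l:\mathbb{R}_{\ge0}\to\mathbb{R}_{\ge0}$ is non-decreasing, differentiable and sub-quadratic (meaning $\lim_{x\to\infty}\frac{l(x)}{x^2}=0$), then there exists a non-decreasing function $\rho_1:\mathbb{R}_{\ge0}\to\mathbb{R}_{\ge0}$, depending on $l$, such that $\|\nabla^2F(w)\|_{\mathrm{op}}\le\rho_1(F(w))$ for all $w\in\mathbb{R}^d$. (ii) Suppose $F$ is $(L_0,L_1)$-smooth, i.e. $\|\nabla^2F(w)\|_{\mathrm{op}}\le L_0+L_1\|\nabla F(w)\|$ for all $w\in\mathbb{R}^d$, with $L_0,L_1\ge0$. Then $\|\nabla^2F(w)\|_{\mathrm{op}}\le\rho_1(F(w))$ for all $w\in\mathbb{R}^d$ with $\rho_1(x)=\frac32L_0+4L_1^2x$.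
   Context: $\|\cdot\|$ is the Euclidean norm of vectors and $\|\cdot\|_{\mathrm{op}}$ the operator norm of matrices. *)

theory Defs
  imports "HOL-Analysis.Analysis"
begin

definition grad :: "(real ^ 'n \<Rightarrow> real) \<Rightarrow> real ^ 'n \<Rightarrow> real ^ 'n"
  where "grad F w = (THE D. GDERIV F w :> D)"

definition hessian :: "(real ^ 'n \<Rightarrow> real) \<Rightarrow> real ^ 'n \<Rightarrow> real ^ 'n ^ 'n"
  where "hessian F w = jacobian (grad F) (at w)"

definition twice_differentiable :: "(real ^ 'n \<Rightarrow> real) \<Rightarrow> bool"
  where "twice_differentiable F \<longleftrightarrow>
    (\<forall>w. F differentiable (at w)) \<and> (\<forall>w. grad F differentiable (at w))"

abbreviation op_norm :: "real ^ 'n ^ 'm \<Rightarrow> real"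
  where "op_norm A \<equiv> onorm ((*v) A)"

definition attains_min_zero :: "('a \<Rightarrow> real) \<Rightarrow> bool"
  where "attains_min_zero F \<longleftrightarrow> (\<forall>w. 0 \<le> F w) \<and> (\<exists>w. F w = 0)"

text \<open>A function from the nonnegative reals to themselves is represented by a function on
  \<^typ>\<open>real\<close> of which only the restriction to \<open>{0..}\<close> is constrained; in particular
  differentiability at \<open>0\<close> is one-sided.\<close>

definition nonneg_nondecreasing :: "(real \<Rightarrow> real) \<Rightarrow> bool"
  where "nonneg_nondecreasing f \<longleftrightarrow> (\<forall>x\<ge>0. 0 \<le> f x) \<and> mono_on {0..} f"

definition sub_quadratic :: "(real \<Rightarrow> real) \<Rightarrow> bool"
  where "sub_quadratic l \<longleftrightarrow> ((\<lambda>x. l x / x\<^sup>2) \<longlongrightarrow> 0) at_top"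

definition L0_L1_smooth :: "real \<Rightarrow> real \<Rightarrow> (real ^ 'n \<Rightarrow> real) \<Rightarrow> bool"
  where "L0_L1_smooth L0 L1 F \<longleftrightarrow>
    (\<forall>w. op_norm (hessian F w) \<le> L0 + L1 * norm (grad F w))"

lemma gderiv_grad:
  fixes F :: "real ^ 'n \<Rightarrow> real"
  assumes "F differentiable (at w)"
  shows "GDERIV F w :> grad F w"
proof -
  obtain f' where f': "(F has_derivative f') (at w)"
    using assms unfolding differentiable_def by blast
  then have lin: "linear f'"
    by (rule has_derivative_linear)
  have eq: "f' = (\<lambda>h. h \<bullet> adjoint f' 1)"
  proof
    fix h show "f' h = h \<bullet> adjoint f' 1"
      using adjoint_works[OF lin, of h "1::real"] by simp
  qed
  have D: "GDERIV F w :> adjoint f' 1"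
    unfolding gderiv_def by (rule has_derivative_eq_rhs[OF f' eq])
  show ?thesis
    unfolding grad_def
  proof (rule theI)
    show "GDERIV F w :> adjoint f' 1" by (rule D)
    fix E assume "GDERIV F w :> E"
    then have "(\<lambda>h. h \<bullet> E) = (\<lambda>h. h \<bullet> adjoint f' 1)"
      using D unfolding gderiv_def by (rule has_derivative_unique)
    then have "\<forall>h. h \<bullet> E = h \<bullet> adjoint f' 1"
      by (simp add: fun_eq_iff)
    then show "E = adjoint f' 1"
      by (rule vector_eq_ldot[THEN iffD1])
  qed
qed

lemma has_derivative_grad:
  assumes "twice_differentiable F"
  shows "(grad F has_derivative (\<lambda>h. hessian F w *v h)) (at w)"
proof -
  have "grad F differentiable (at w)"
    using assms unfolding twice_differentiable_def by (elim conjE allE)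
  then show ?thesis
    unfolding hessian_def by (rule jacobian_works[THEN iffD1])
qed

end

(* Where the gradient norm is at most 2g the Hessian is bounded by l (2g). Moving from w by at
   most g / l (2g), where g is the gradient norm at w, changes the gradient by at most g and hence
   stays in that region. The descent inequality for the step g / l (2g) along the negative
   gradient, together with F \<ge> 0, gives g^2 \<le> 2 l (2g) F w. Sub-quadratic growth of l
   turns this into a bound on g in terms of F w; for affine l the bound is explicit. *)

theory Submission
  imports Defs
begin

section \<open>Variation of the gradient along a segment\<close>

text \<open>Mean value inequality. Bounding the Hessian only at interior points lets the lemma apply
  up to a point where the control of the gradient is about to fail.\<close>

lemma norm_grad_diff_le:
  fixes F :: "real ^ 'n \<Rightarrow> real"
  assumes td: "twice_differentiable F" and v: "norm v = 1" and "0 < t"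
    and H: "\<And>s. 0 < s \<Longrightarrow> s < t \<Longrightarrow> op_norm (hessian F (w + s *\<^sub>R v)) \<le> L"
  shows "norm (grad F (w + t *\<^sub>R v) - grad F w) \<le> L * t"
proof -
  let ?f = "\<lambda>s. grad F (w + s *\<^sub>R v)"
  have der: "(?f has_derivative (\<lambda>h. hessian F (w + s *\<^sub>R v) *v (h *\<^sub>R v))) (at s)" for s
    by (rule has_derivative_compose[OF _ has_derivative_grad[OF td], of "\<lambda>s. w + s *\<^sub>R v"])
      (auto intro!: derivative_eq_intros)
  have "continuous_on {0..t} ?f"
    by (intro continuous_at_imp_continuous_on ballI has_derivative_continuous[OF der])
  then obtain s where s: "s \<in> {0<..<t}"
    and le: "norm (?f t - ?f 0) \<le> norm (hessian F (w + s *\<^sub>R v) *v ((t - 0) *\<^sub>R v))"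
    using mvt_general[OF \<open>0 < t\<close>, of ?f "\<lambda>s h. hessian F (w + s *\<^sub>R v) *v (h *\<^sub>R v)"] der
    by blast
  have "norm (hessian F (w + s *\<^sub>R v) *v ((t - 0) *\<^sub>R v))
      \<le> op_norm (hessian F (w + s *\<^sub>R v)) * norm ((t - 0) *\<^sub>R v)"
    by (rule onorm) (rule matrix_vector_mul_bounded_linear)
  also have "\<dots> = op_norm (hessian F (w + s *\<^sub>R v)) * t"
    using v \<open>0 < t\<close> by simp
  also have "\<dots> \<le> L * t"
    using H s \<open>0 < t\<close> by (auto intro!: mult_right_mono)
  finally show ?thesis
    using le by simp
qed

text \<open>First-exit argument: before the gradient has changed by its initial norm g, its norm is
  at most 2g, so the Hessian is bounded by \<open>l (2 * g)\<close>. At that rate, a change of g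
  needs a distance larger than \<open>g / L\<close>.\<close>

lemma norm_grad_diff_less:
  fixes F :: "real ^ 'n \<Rightarrow> real"
  assumes td: "twice_differentiable F" and v: "norm v = 1"
    and mono: "mono_on {0..} l"
    and H: "\<And>w. op_norm (hessian F w) \<le> l (norm (grad F w))"
    and g: "0 < norm (grad F w)"
    and L: "l (2 * norm (grad F w)) < L" "0 < L"
    and t: "0 \<le> t" "t \<le> norm (grad F w) / L"
  shows "norm (grad F (w + t *\<^sub>R v) - grad F w) < norm (grad F w)"
proof (rule ccontr)
  let ?g = "norm (grad F w)"
  let ?\<phi> = "\<lambda>s. norm (grad F (w + s *\<^sub>R v) - grad F w)"
  let ?S = "{s \<in> {0..t}. ?g \<le> ?\<phi> s}"
  assume "\<not> ?\<phi> t < ?g"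
  then have ne: "t \<in> ?S"
    using t by auto
  have grad_cont: "continuous_on UNIV (grad F)"
    by (intro continuous_at_imp_continuous_on ballI
        has_derivative_continuous[OF has_derivative_grad[OF td]])
  have "continuous_on {0..t} ?\<phi>"
    by (intro continuous_intros continuous_on_compose2[OF grad_cont]) auto
  then have "closed ?S"
    by (rule continuous_on_closed_Collect_le[OF continuous_on_const]) simp
  moreover have bdd: "bdd_below ?S"
    by (rule bdd_belowI[of _ 0]) auto
  \<comment> \<open>\<open>?S\<close> is closed, so there is a first point at which the change
    reaches g; all earlier points lie outside \<open>?S\<close>.\<close>
  ultimately have inf: "Inf ?S \<in> ?S"
    using ne by (intro closed_contains_Inf) auto
  define s where "s = Inf ?S"
  have s: "0 \<le> s" "s \<le> t" "?g \<le> ?\<phi> s"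
    using inf by (auto simp: s_def)
  have "s \<noteq> 0"
    using s(3) g by auto
  with s have "0 < s" by simp
  have "op_norm (hessian F (w + r *\<^sub>R v)) \<le> l (2 * ?g)" if r: "0 < r" "r < s" for r
  proof -
    have "r \<notin> ?S"
      using cInf_lower[OF _ bdd, of r] r by (auto simp: s_def)
    then have "?\<phi> r < ?g"
      using r s by auto
    then have "norm (grad F (w + r *\<^sub>R v)) \<le> 2 * ?g"
      using norm_triangle_sub[of "grad F (w + r *\<^sub>R v)" "grad F w"] by simp
    then have "l (norm (grad F (w + r *\<^sub>R v))) \<le> l (2 * ?g)"
      by (intro mono_onD[OF mono]) auto
    then show ?thesis
      using H[of "w + r *\<^sub>R v"] by linarith
  qed
  then have "?\<phi> s \<le> l (2 * ?g) * s"
    by (rule norm_grad_diff_le[OF td v \<open>0 < s\<close>])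
  \<comment> \<open>The strict gap between \<open>l (2 * ?g)\<close> and \<open>L\<close> excludes a
    change of exactly g at \<open>s\<close>.\<close>
  also have "\<dots> < L * s"
    using L \<open>0 < s\<close> by simp
  also have "\<dots> \<le> L * (?g / L)"
    using s t L by (intro mult_left_mono) auto
  also have "\<dots> = ?g"
    using L by simp
  finally show False
    using s by simp
qed

section \<open>The descent inequality\<close>

lemma norm_grad_square_le:
  fixes F :: "real ^ 'n \<Rightarrow> real"
  assumes td: "twice_differentiable F" and F: "\<And>w. 0 \<le> F w"
    and mono: "mono_on {0..} l" and l: "\<And>x. 0 \<le> x \<Longrightarrow> 0 \<le> l x"
    and H: "\<And>w. op_norm (hessian F w) \<le> l (norm (grad F w))"
  shows "(norm (grad F w))\<^sup>2 \<le> 2 * l (2 * norm (grad F w)) * F w"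
proof (cases "grad F w = 0")
  case True
  then show ?thesis
    using F l by simp
next
  case False
  define g where "g = norm (grad F w)"
  define v where "v = - (grad F w /\<^sub>R g)"
  have g: "0 < g"
    using False by (simp add: g_def)
  have v: "norm v = 1"
    using False by (simp add: v_def g_def)
  have v_grad: "v \<bullet> grad F w = - g"
    using g by (simp add: v_def g_def dot_square_norm power2_eq_square)
  \<comment> \<open>A strictly larger \<open>L\<close> is what the first-exit lemma asks for; it is
    also positive when \<open>l (2 * g) = 0\<close>, so \<open>g / L\<close> makes sense. A limit
    removes the slack at the end.\<close>
  have step: "g\<^sup>2 \<le> 2 * L * F w" if L: "l (2 * g) < L" for L
  proof -
    have "0 < L"
      using L l[of "2 * g"] g by simp
    \<comment> \<open>That \<open>?\<psi>\<close> does not exceed its initial value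
      \<open>F w\<close> is the quadratic upper bound on F along the ray. \<open>?T\<close>
      minimizes that bound and is also the longest step the first-exit lemma permits.\<close>
    let ?\<psi> = "\<lambda>t. F (w + t *\<^sub>R v) + g * t - L * t\<^sup>2 / 2"
    let ?T = "g / L"
    have F_der: "(F has_derivative (\<lambda>h. h \<bullet> grad F x)) (at x)" for x
      using gderiv_grad[of F x] td
      unfolding twice_differentiable_def gderiv_def by blast
    have line: "((\<lambda>t. F (w + t *\<^sub>R v)) has_real_derivative (v \<bullet> grad F (w + t *\<^sub>R v))) (at t)" for t
    proof -
      have "((\<lambda>t. F (w + t *\<^sub>R v)) has_derivative (\<lambda>h. (h *\<^sub>R v) \<bullet> grad F (w + t *\<^sub>R v))) (at t)"
        by (rule has_derivative_compose[OF _ F_der, of "\<lambda>t. w + t *\<^sub>R v"])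
          (auto intro!: derivative_eq_intros)
      then show ?thesis
        unfolding has_field_derivative_def by (rule has_derivative_eq_rhs) (auto simp: mult.commute)
    qed
    have "?\<psi> ?T \<le> ?\<psi> 0"
    proof (rule DERIV_nonpos_imp_nonincreasing[where f = ?\<psi>])
      show "0 \<le> ?T"
        using g \<open>0 < L\<close> by simp
      fix t assume t: "0 \<le> t" "t \<le> ?T"
      have "(?\<psi> has_real_derivative (v \<bullet> grad F (w + t *\<^sub>R v) + g - L * t)) (at t)"
        by (auto intro!: derivative_eq_intros line)
      \<comment> \<open>Since \<open>v \<bullet> grad F w = - g\<close>, only the change of the
        gradient is left to compare with \<open>L * t\<close>.\<close>
      moreover have "v \<bullet> grad F (w + t *\<^sub>R v) + g - L * t \<le> 0"
      proof -
        have "norm (grad F (w + t *\<^sub>R v) - grad F w) \<le> L * t"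
        proof (cases "t = 0")
          case False
          have "op_norm (hessian F (w + s *\<^sub>R v)) \<le> L" if s: "0 < s" "s < t" for s
          proof -
            have "norm (grad F (w + s *\<^sub>R v) - grad F w) < g"
              unfolding g_def
              by (rule norm_grad_diff_less[OF td v mono H])
                (use g L \<open>0 < L\<close> s t in \<open>auto simp: g_def\<close>)
            then have "norm (grad F (w + s *\<^sub>R v)) \<le> 2 * g"
              using norm_triangle_sub[of "grad F (w + s *\<^sub>R v)" "grad F w"] by (simp add: g_def)
            then have "l (norm (grad F (w + s *\<^sub>R v))) \<le> l (2 * g)"
              using g by (intro mono_onD[OF mono]) auto
            then show ?thesis
              using H[of "w + s *\<^sub>R v"] L by linarith
          qed
          then show ?thesis
            using False t by (intro norm_grad_diff_le[OF td v]) auto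
        qed simp
        moreover have "v \<bullet> (grad F (w + t *\<^sub>R v) - grad F w)
            \<le> norm (grad F (w + t *\<^sub>R v) - grad F w)"
          using norm_cauchy_schwarz[of v "grad F (w + t *\<^sub>R v) - grad F w"] v by simp
        ultimately show ?thesis
          using v_grad by (simp add: inner_diff_right)
      qed
      ultimately show "\<exists>y. (?\<psi> has_real_derivative y) (at t) \<and> y \<le> 0"
        by blast
    qed
    \<comment> \<open>The left side equals \<open>g\<^sup>2 / (2 * L)\<close>.\<close>
    then have "g * ?T - L * ?T\<^sup>2 / 2 \<le> F w"
      using F[of "w + ?T *\<^sub>R v"] by simp
    then show ?thesis
      using \<open>0 < L\<close> by (simp add: field_simps power2_eq_square)
  qed
  \<comment> \<open>Let \<open>L\<close> decrease to \<open>l (2 * g)\<close>; no continuity of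
    \<open>l\<close> is involved, as g is fixed.\<close>
  have "((\<lambda>L. 2 * L * F w) \<longlongrightarrow> 2 * l (2 * g) * F w) (at_right (l (2 * g)))"
    by (intro tendsto_intros)
  then have "g\<^sup>2 \<le> 2 * l (2 * g) * F w"
  proof (rule tendsto_lowerbound)
    show "\<forall>\<^sub>F L in at_right (l (2 * g)). g\<^sup>2 \<le> 2 * L * F w"
      using eventually_at_right_less by (rule eventually_mono) (rule step)
  qed simp
  then show ?thesis
    by (simp add: g_def)
qed

section \<open>Solving the inequality for the gradient norm\<close>

lemma sub_quadratic_bounded:
  assumes "sub_quadratic l"
  shows "\<exists>N\<ge>0. \<forall>g. g\<^sup>2 \<le> 2 * l (2 * g) * x \<longrightarrow> g \<le> N"
proof -
  \<comment> \<open>If \<open>l (2 * g)\<close> is below \<open>c * (2 * g)\<^sup>2\<close>, the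
    right side of the inequality is at most \<open>8 * c * \<bar>x\<bar> * g\<^sup>2\<close>; this
    \<open>c\<close> makes the factor less than 1, which rules out large g.\<close>
  define c where "c = 1 / (8 * (\<bar>x\<bar> + 1))"
  have c: "0 < c" and cx: "8 * c * \<bar>x\<bar> < 1"
    by (auto simp: c_def field_simps)
  have "\<forall>\<^sub>F y in at_top. \<bar>l y / y\<^sup>2\<bar> < c"
    using assms c unfolding sub_quadratic_def tendsto_iff dist_real_def by simp
  then obtain M where M: "\<And>y. M \<le> y \<Longrightarrow> \<bar>l y / y\<^sup>2\<bar> < c"
    unfolding eventually_at_top_linorder by blast
  have "g \<le> max 0 M" if le: "g\<^sup>2 \<le> 2 * l (2 * g) * x" for g
  proof (rule ccontr)
    assume "\<not> g \<le> max 0 M"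
    then have g: "0 < g" "M \<le> 2 * g"
      by auto
    have "\<bar>l (2 * g)\<bar> < c * (2 * g)\<^sup>2"
      using M[OF g(2)] g by (simp add: abs_div pos_divide_less_eq)
    then have "2 * \<bar>l (2 * g)\<bar> * \<bar>x\<bar> \<le> 2 * (c * (2 * g)\<^sup>2) * \<bar>x\<bar>"
      by (intro mult_right_mono mult_left_mono) auto
    also have "\<dots> = (8 * c * \<bar>x\<bar>) * g\<^sup>2"
      by (simp add: power2_eq_square)
    also have "\<dots> < g\<^sup>2"
      using mult_strict_right_mono[OF cx, of "g\<^sup>2"] g by simp
    finally have "2 * \<bar>l (2 * g)\<bar> * \<bar>x\<bar> < g\<^sup>2" .
    moreover have "2 * l (2 * g) * x \<le> 2 * \<bar>l (2 * g)\<bar> * \<bar>x\<bar>"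
      using abs_ge_self[of "2 * l (2 * g) * x"] by (simp add: abs_mult)
    ultimately show False
      using le by linarith
  qed
  then show ?thesis
    by (intro exI[of _ "max 0 M"]) auto
qed

text \<open>Take for \<open>\<rho> x\<close> the supremum of \<open>l\<close> over all gradient
  norms compatible with the value \<open>x\<close>. These form a bounded set that grows with
  \<open>x\<close>, and 0 belongs to it whenever \<open>0 \<le> x\<close>.\<close>

lemma sub_quadratic_value_bound:
  assumes l: "nonneg_nondecreasing l" and sq: "sub_quadratic l"
  shows "\<exists>\<rho>. nonneg_nondecreasing \<rho> \<and>
    (\<forall>g\<ge>0. \<forall>x. g\<^sup>2 \<le> 2 * l (2 * g) * x \<longrightarrow> l g \<le> \<rho> x)"
proof -
  have l0: "\<And>x. 0 \<le> x \<Longrightarrow> 0 \<le> l x" and mono: "mono_on {0..} l"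
    using l by (auto simp: nonneg_nondecreasing_def)
  define A where "A x = {g. 0 \<le> g \<and> g\<^sup>2 \<le> 2 * l (2 * g) * x}" for x
  define \<rho> where "\<rho> x = Sup (l ` A x)" for x
  have bdd: "bdd_above (l ` A x)" for x
  proof -
    obtain N where "\<And>g. g\<^sup>2 \<le> 2 * l (2 * g) * x \<Longrightarrow> g \<le> N" "0 \<le> N"
      using sub_quadratic_bounded[OF sq] by blast
    then show ?thesis
      by (intro bdd_aboveI[of _ "l N"]) (auto simp: A_def intro!: mono_onD[OF mono])
  qed
  have upper: "l g \<le> \<rho> x" if "g \<in> A x" for g x
    unfolding \<rho>_def using bdd that by (intro cSup_upper) auto
  have zero: "0 \<in> A x" if "0 \<le> x" for x
    using that l0 by (simp add: A_def)
  have A_mono: "A x \<subseteq> A y" if "x \<le> y" for x y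
  proof
    fix g assume g: "g \<in> A x"
    then have "2 * l (2 * g) * x \<le> 2 * l (2 * g) * y"
      using that l0 by (intro mult_left_mono) (auto simp: A_def)
    with g show "g \<in> A y"
      by (auto simp: A_def)
  qed
  have "nonneg_nondecreasing \<rho>"
    unfolding nonneg_nondecreasing_def
  proof (intro conjI allI impI mono_onI)
    fix x :: real assume "0 \<le> x"
    then show "0 \<le> \<rho> x"
      using upper[OF zero] l0[of 0] by fastforce
  next
    fix x y :: real assume "x \<in> {0..}" "x \<le> y"
    then show "\<rho> x \<le> \<rho> y"
      unfolding \<rho>_def using zero[of x] A_mono[of x y] bdd
      by (intro cSup_subset_mono) auto
  qed
  then show ?thesis
    using upper by (intro exI[of _ \<rho>]) (auto simp: A_def)
qed

text \<open>The hypothesis says \<open>x * (x - 4 * y) \<le> 2 * a * y\<close>. If x exceeded the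
  claimed bound, the left side would be at least \<open>a\<^sup>2 / 4 + 2 * a * y\<close>, which
  forces \<open>a = 0\<close>; then \<open>x \<le> 4 * y\<close>, a contradiction.\<close>

lemma quadratic_bound:
  fixes a b x y :: real
  assumes "x\<^sup>2 \<le> 2 * (a + 2 * x) * y" "0 \<le> a" "0 \<le> y"
  shows "x \<le> a / 2 + 4 * y"
proof (rule ccontr)
  assume "\<not> ?thesis"
  then have x: "a / 2 + 4 * y < x" by simp
  then have "(a / 2 + 4 * y) * (a / 2) \<le> x * (x - 4 * y)"
    using assms by (intro mult_mono) auto
  moreover have "x * (x - 4 * y) \<le> 2 * a * y"
    using assms by (simp add: algebra_simps power2_eq_square)
  ultimately have "a * a \<le> 0"
    by (simp add: algebra_simps)
  then have "a = 0"
    by (metis mult_eq_0_iff order_antisym zero_le_square)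
  then have "x * x \<le> x * (4 * y)"
    using assms by (simp add: algebra_simps power2_eq_square)
  then show False
    using x \<open>a = 0\<close> assms by simp
qed

theorem propositionA1:
  shows "(\<forall>l :: real \<Rightarrow> real.
            nonneg_nondecreasing l \<and> l differentiable_on {0..} \<and> sub_quadratic l \<longrightarrow>
            (\<exists>\<rho>\<^sub>1 :: real \<Rightarrow> real. nonneg_nondecreasing \<rho>\<^sub>1 \<and>
              (\<forall>F :: real ^ 'n \<Rightarrow> real.
                 twice_differentiable F \<and> attains_min_zero F \<and>
                 (\<forall>w. op_norm (hessian F w) \<le> l (norm (grad F w))) \<longrightarrow>
                 (\<forall>w. op_norm (hessian F w) \<le> \<rho>\<^sub>1 (F w))))) \<and>
         (\<forall>(F :: real ^ 'n \<Rightarrow> real) (L0 :: real) (L1 :: real).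
            twice_differentiable F \<and> attains_min_zero F \<and>
            0 \<le> L0 \<and> 0 \<le> L1 \<and> L0_L1_smooth L0 L1 F \<longrightarrow>
            (\<forall>w. op_norm (hessian F w) \<le> 3 / 2 * L0 + 4 * L1\<^sup>2 * F w))"
proof (intro conjI allI impI)
  fix l :: "real \<Rightarrow> real"
  assume "nonneg_nondecreasing l \<and> l differentiable_on {0..} \<and> sub_quadratic l"
  then have l: "nonneg_nondecreasing l" and sq: "sub_quadratic l"
    by auto
  \<comment> \<open>\<open>\<rho>\<close> is chosen before F, so it depends on \<open>l\<close>
    alone.\<close>
  obtain \<rho> where \<rho>: "nonneg_nondecreasing \<rho>"
    and bound: "\<And>g x. 0 \<le> g \<Longrightarrow> g\<^sup>2 \<le> 2 * l (2 * g) * x \<Longrightarrow> l g \<le> \<rho> x"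
    using sub_quadratic_value_bound[OF l sq] by blast
  have "op_norm (hessian F w) \<le> \<rho> (F w)"
    if F: "twice_differentiable F" "attains_min_zero F"
      and H: "\<forall>w. op_norm (hessian F w) \<le> l (norm (grad F w))"
    for F :: "real ^ 'n \<Rightarrow> real" and w
  proof -
    have "(norm (grad F w))\<^sup>2 \<le> 2 * l (2 * norm (grad F w)) * F w"
      using F H l
      by (intro norm_grad_square_le) (auto simp: attains_min_zero_def nonneg_nondecreasing_def)
    then have "l (norm (grad F w)) \<le> \<rho> (F w)"
      by (intro bound) auto
    then show ?thesis
      using H order_trans by blast
  qed
  with \<rho> show "\<exists>\<rho>\<^sub>1 :: real \<Rightarrow> real. nonneg_nondecreasing \<rho>\<^sub>1 \<and>
      (\<forall>F :: real ^ 'n \<Rightarrow> real.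
         twice_differentiable F \<and> attains_min_zero F \<and>
         (\<forall>w. op_norm (hessian F w) \<le> l (norm (grad F w))) \<longrightarrow>
         (\<forall>w. op_norm (hessian F w) \<le> \<rho>\<^sub>1 (F w)))"
    by blast
next
  fix F :: "real ^ 'n \<Rightarrow> real" and L0 L1 :: real and w :: "real ^ 'n"
  assume asm: "twice_differentiable F \<and> attains_min_zero F \<and>
    0 \<le> L0 \<and> 0 \<le> L1 \<and> L0_L1_smooth L0 L1 F"
  then have F: "0 \<le> F w"
    by (simp add: attains_min_zero_def)
  let ?g = "norm (grad F w)"
  have H: "op_norm (hessian F w) \<le> L0 + L1 * ?g"
    using asm by (simp add: L0_L1_smooth_def)
  have "?g\<^sup>2 \<le> 2 * (L0 + L1 * (2 * ?g)) * F w"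
    using asm by (intro norm_grad_square_le[of F "\<lambda>x. L0 + L1 * x"])
      (auto simp: attains_min_zero_def L0_L1_smooth_def intro!: mono_onI mult_left_mono)
  \<comment> \<open>Scaling by \<open>L1\<^sup>2\<close> turns this into an inequality for
    \<open>L1 * ?g\<close>, with no division when \<open>L1 = 0\<close>. The resulting
    \<open>L0 / 2\<close> and the \<open>L0\<close> of the smoothness bound add up to
    \<open>3 / 2 * L0\<close>.\<close>
  then have "L1\<^sup>2 * ?g\<^sup>2 \<le> L1\<^sup>2 * (2 * (L0 + L1 * (2 * ?g)) * F w)"
    by (intro mult_left_mono) auto
  then have "(L1 * ?g)\<^sup>2 \<le> 2 * (L0 + 2 * (L1 * ?g)) * (L1\<^sup>2 * F w)"
    by (simp add: algebra_simps power2_eq_square)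
  then have "L1 * ?g \<le> L0 / 2 + 4 * (L1\<^sup>2 * F w)"
    using asm F by (intro quadratic_bound) auto
  then show "op_norm (hessian F w) \<le> 3 / 2 * L0 + 4 * L1\<^sup>2 * F w"
    using H by simp
qed

end
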